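(* Let $F:\mathbb{R}^d\to\mathbb{R}^d$ be monotone with $\mathcal X_*=\{x\in\mathbb{R}^d:F(x)=0\}\neq\emptyset$, and let $x_*\in\mathcal X_*$. Let $x_0\in\mathbb{R}^d$ and let $(x_k,\hat x_k,\alpha_k)_{k\ge 0}$ be generated by PolyakEG with extrapolation step-sizes $\gamma_k>0$, where for a fixed constant $A$ the critical condition $$\|F(\hat x_k)-F(x_k)\|\le A\|F(x_k)\|$$ holds for all $k\ge 0$. Then: 1. If $A\in(0,1]$, then for every $K\ge 0$, $$\min_{k=0,\dots,K}\gamma_k^2\|F(\hat x_k)\|^2\le\frac{(1+A)^2\|x_0-x_*\|^2}{K+1}.$$ 2. If $A\in(0,1)$, then for every $K\ge 0$, $$\min_{k=0,\dots,K}\gamma_k^2\|F(x_k)\|^2\le\frac{(1+A)\|x_0-x_*\|^2}{(1-A)(K+1)}.$$ 3. If $F$ is $\mu$-strongly monotone for some $\mu>0$ and $A\in(0,1)$, then for every $k\ge 0$, $$\|x_{k+1}-x_*\|^2\le\prod_{j=0}^{k}\left(1-\frac{2(1-A)\gamma_j\mu}{(1+A)^2}\right)\|x_0-x_*\|^2.$$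
   Context: $\langle\cdot,\cdot\rangle$ and $\|\cdot\|$ are the Euclidean inner product and norm on $\mathbb{R}^d$. $F$ is monotone if $\langle F(x)-F(y),x-y\rangle\ge 0$ for all $x,y\in\mathbb{R}^d$; for $\mu>0$, $F$ is $\mu$-strongly monotone if $\langle F(x)-F(y),x-y\rangle\ge\mu\|x-y\|^2$ for all $x,y\in\mathbb{R}^d$. PolyakEG: given $x_0\in\mathbb{R}^d$ and step-sizes $\gamma_k>0$, iterate for $k=0,1,2,\dots$ $$\hat x_k=x_k-\gamma_kF(x_k),\qquad \alpha_k=\frac{\langle F(\hat x_k),x_k-\hat x_k\rangle}{\|F(\hat x_k)\|^2},\qquad x_{k+1}=x_k-\alpha_kF(\hat x_k).$$ It is assumed that $F(\hat x_k)\ne 0$ at every iteration considered, so that $\alpha_k$ is defined (if $F(\hat x_k)=0$, then $\hat x_k$ is a solution and the algorithm terminates). *)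

theory Defs
  imports "HOL-Analysis.Analysis"
begin

definition monotone_operator :: "(real ^ 'd \<Rightarrow> real ^ 'd) \<Rightarrow> bool" where
  "monotone_operator F \<longleftrightarrow> (\<forall>x y. (F x - F y) \<bullet> (x - y) \<ge> 0)"

definition strongly_monotone_operator :: "real \<Rightarrow> (real ^ 'd \<Rightarrow> real ^ 'd) \<Rightarrow> bool" where
  "strongly_monotone_operator \<mu> F \<longleftrightarrow>
     (\<forall>x y. (F x - F y) \<bullet> (x - y) \<ge> \<mu> * (norm (x - y))\<^sup>2)"

definition solution_set :: "(real ^ 'd \<Rightarrow> real ^ 'd) \<Rightarrow> (real ^ 'd) set" where
  "solution_set F = {x. F x = 0}"

(* The iterations considered are those with index k < N. N = \<infinity> is a run that never
   terminates; a finite N also covers a run that stops at iteration N because F (xh N) = 0.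
   In a considered iteration F (xh k) is nonzero, so the division in \<alpha> k is a genuine one. *)
definition polyakEG ::
  "(real ^ 'd \<Rightarrow> real ^ 'd) \<Rightarrow> (nat \<Rightarrow> real) \<Rightarrow> real ^ 'd \<Rightarrow> enat \<Rightarrow>
   (nat \<Rightarrow> real ^ 'd) \<Rightarrow> (nat \<Rightarrow> real ^ 'd) \<Rightarrow> (nat \<Rightarrow> real) \<Rightarrow> bool" where
  "polyakEG F \<gamma> x0 N x xh \<alpha> \<longleftrightarrow>
     x 0 = x0 \<and>
     (\<forall>k. enat k < N \<longrightarrow>
        \<gamma> k > 0 \<and>
        xh k = x k - \<gamma> k *\<^sub>R F (x k) \<and>
        F (xh k) \<noteq> 0 \<and>
        \<alpha> k = (F (xh k) \<bullet> (x k - xh k)) / (norm (F (xh k)))\<^sup>2 \<and>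
        x (Suc k) = x k - \<alpha> k *\<^sub>R F (xh k))"

end

theory Submission
  imports Defs
begin

text \<open>
  Write \<open>g = F (x k)\<close>, \<open>h = F (xh k)\<close> and \<open>D = x k - xs\<close>. The Polyak step-size is the one for which the
  hyperplane through \<open>xh k\<close> with normal \<open>h\<close> contains \<open>x (Suc k)\<close>; in other words \<open>x (Suc k)\<close> is the
  orthogonal projection of \<open>x k\<close> onto that hyperplane. Monotonicity puts \<open>xs\<close> on the far side of it,
  so the step decreases the squared distance to \<open>xs\<close> by at least the squared step length
  \<open>\<alpha>\<^sup>2 \<parallel>h\<parallel>\<^sup>2 = \<gamma>\<^sup>2 (h \<bullet> g)\<^sup>2 / \<parallel>h\<parallel>\<^sup>2\<close> (\<open>polyak_step_distance\<close>).

  The critical condition keeps \<open>h\<close> aligned with \<open>g\<close>, in two forms: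
  \<open>\<parallel>h\<parallel>\<^sup>2 \<le> (1 + A) (h \<bullet> g)\<close> and \<open>(1 - A) \<parallel>g\<parallel>\<^sup>2 \<le> h \<bullet> g\<close>. The square of the first bounds the decrease
  from below by a multiple of \<open>\<gamma>\<^sup>2 \<parallel>h\<parallel>\<^sup>2\<close>, and the product of the two bounds it by a multiple of
  \<open>\<gamma>\<^sup>2 \<parallel>g\<parallel>\<^sup>2\<close>. Summing the decreases telescopes, and the minimum is at most the average, which gives
  the two rates of order \<open>1 / (K + 1)\<close>.

  Under strong monotonicity the decrease gains a term \<open>2 \<alpha> \<mu> \<parallel>xh k - xs\<parallel>\<^sup>2\<close>. Since
  \<open>D = \<gamma> g + (xh k - xs)\<close>, the two decrease terms together control \<open>\<parallel>D\<parallel>\<^sup>2\<close> through a weighted Young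
  inequality. Its weights are compatible as soon as \<open>\<gamma> \<mu> \<le> A\<close>, and this restriction on the step-size is
  automatic: strong monotonicity expands \<open>F\<close> by at least \<open>\<mu>\<close> along the extrapolation step, while the
  critical condition allows a change of at most \<open>A \<parallel>g\<parallel>\<close>.
\<close>

section \<open>Alignment under the critical condition\<close>

text \<open>
  Expanding \<open>\<parallel>h - g\<parallel>\<^sup>2 \<le> A\<^sup>2 \<parallel>g\<parallel>\<^sup>2\<close> bounds \<open>2 (h \<bullet> g)\<close> below by \<open>\<parallel>h\<parallel>\<^sup>2 + (1 - A\<^sup>2) \<parallel>g\<parallel>\<^sup>2\<close>; the triangle
  inequality \<open>\<parallel>h\<parallel> \<le> (1 + A) \<parallel>g\<parallel>\<close> then converts the second summand into a multiple of \<open>\<parallel>h\<parallel>\<^sup>2\<close>, and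
  \<open>1 + (1 - A) / (1 + A) = 2 / (1 + A)\<close>.
\<close>
lemma norm_sq_le_inner_of_close:
  fixes g h :: "'a::real_inner"
  assumes A: "0 \<le> A" "A \<le> 1" and crit: "norm (h - g) \<le> A * norm g"
  shows "(norm h)\<^sup>2 \<le> (1 + A) * (h \<bullet> g)"
proof -
  have "(norm (h - g))\<^sup>2 \<le> (A * norm g)\<^sup>2"
    using crit by (intro power_mono) auto
  then have 1: "(norm h)\<^sup>2 + (1 - A\<^sup>2) * (norm g)\<^sup>2 \<le> 2 * (h \<bullet> g)"
    by (simp add: power2_norm_eq_inner inner_diff_left inner_diff_right inner_commute
        power_mult_distrib algebra_simps)
  have "norm h \<le> norm g + norm (h - g)"
    using norm_triangle_ineq[of g "h - g"] by simp
  then have "norm h \<le> (1 + A) * norm g"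
    using crit by (simp add: algebra_simps)
  then have "(norm h)\<^sup>2 \<le> ((1 + A) * norm g)\<^sup>2"
    by (intro power_mono) auto
  then have "(1 - A) * (norm h)\<^sup>2 \<le> (1 - A) * ((1 + A) * norm g)\<^sup>2"
    using A by (intro mult_left_mono) auto
  also have "\<dots> = (1 + A) * ((1 - A\<^sup>2) * (norm g)\<^sup>2)"
    by (simp add: power2_eq_square algebra_simps)
  also have "\<dots> \<le> (1 + A) * (2 * (h \<bullet> g) - (norm h)\<^sup>2)"
    using A 1 by (intro mult_left_mono) auto
  finally show ?thesis
    by (simp add: algebra_simps)
qed

lemma inner_ge_of_close:
  fixes g h :: "'a::real_inner"
  assumes crit: "norm (h - g) \<le> A * norm g"
  shows "(1 - A) * (norm g)\<^sup>2 \<le> h \<bullet> g"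
proof -
  have "- ((h - g) \<bullet> g) \<le> norm (h - g) * norm g"
    using Cauchy_Schwarz_ineq2[of "h - g" g] by linarith
  also have "\<dots> \<le> A * norm g * norm g"
    using crit by (intro mult_right_mono) auto
  finally show ?thesis
    by (simp add: inner_diff_left power2_eq_square algebra_simps flip: power2_norm_eq_inner)
qed

section \<open>Length of the Polyak step\<close>

text \<open>
  With \<open>D = x - xs\<close> and \<open>e = x - xh\<close>, this is Pythagoras for the projection of \<open>x\<close> onto the hyperplane
  through \<open>xh\<close> orthogonal to \<open>h\<close>; the last term is the one whose sign monotonicity provides, because
  \<open>D - e = xh - xs\<close>.
\<close>
lemma polyak_step_distance:
  fixes D e h :: "'a::real_inner"
  assumes "h \<noteq> 0" and a: "a = (h \<bullet> e) / (norm h)\<^sup>2"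
  shows "(norm (D - a *\<^sub>R h))\<^sup>2 = (norm D)\<^sup>2 - a\<^sup>2 * (norm h)\<^sup>2 - 2 * a * (h \<bullet> (D - e))"
proof -
  have he: "h \<bullet> e = a * (norm h)\<^sup>2"
    using assms by simp
  have "(norm (D - a *\<^sub>R h))\<^sup>2 = (norm D)\<^sup>2 - 2 * a * (h \<bullet> D) + a\<^sup>2 * (norm h)\<^sup>2"
    unfolding power2_norm_eq_inner
    by (simp add: inner_diff_left inner_diff_right inner_commute power2_eq_square)
  also have "\<dots> = (norm D)\<^sup>2 - a\<^sup>2 * (norm h)\<^sup>2 - 2 * a * (h \<bullet> (D - e))"
    by (simp add: inner_diff_right he power2_eq_square algebra_simps)
  finally show ?thesis .
qed

lemma polyak_stepsize_ge:
  fixes g h :: "'a::real_inner"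
  assumes "0 \<le> A" "A \<le> 1" "norm (h - g) \<le> A * norm g" "h \<noteq> 0" "0 < c"
    and a: "a = (h \<bullet> (c *\<^sub>R g)) / (norm h)\<^sup>2"
  shows "c / (1 + A) \<le> a"
proof -
  have "c * (norm h)\<^sup>2 \<le> c * ((1 + A) * (h \<bullet> g))"
    using norm_sq_le_inner_of_close[OF assms(1-3)] \<open>0 < c\<close> by (intro mult_left_mono) auto
  also have "\<dots> = (1 + A) * (a * (norm h)\<^sup>2)"
    using a \<open>h \<noteq> 0\<close> by simp
  finally have "c * (norm h)\<^sup>2 \<le> ((1 + A) * a) * (norm h)\<^sup>2"
    by (simp add: mult.assoc)
  then have "c \<le> (1 + A) * a"
    using \<open>h \<noteq> 0\<close> by (simp add: mult_le_cancel_right)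
  then show ?thesis
    using \<open>0 \<le> A\<close> by (simp add: pos_divide_le_eq mult.commute)
qed

text \<open>
  The product of the two alignment bounds gives
  \<open>(1 - A) \<parallel>g\<parallel>\<^sup>2 \<parallel>h\<parallel>\<^sup>2 \<le> (1 + A) (h \<bullet> g)\<^sup>2\<close>, in which \<open>\<parallel>h\<parallel>\<^sup>2\<close> cancels against the denominator of the
  step-size.
\<close>
lemma polyak_step_length_ge:
  fixes g h :: "'a::real_inner"
  assumes A: "0 \<le> A" "A \<le> 1" and crit: "norm (h - g) \<le> A * norm g" and "h \<noteq> 0"
    and a: "a = (h \<bullet> (c *\<^sub>R g)) / (norm h)\<^sup>2"
  shows "(1 - A) * (c\<^sup>2 * (norm g)\<^sup>2) \<le> (1 + A) * (a\<^sup>2 * (norm h)\<^sup>2)"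
proof -
  have "0 \<le> h \<bullet> g"
    using inner_ge_of_close[OF crit] A by (smt (verit) mult_nonneg_nonneg zero_le_power2)
  then have "((1 - A) * (norm g)\<^sup>2) * (norm h)\<^sup>2 \<le> (h \<bullet> g) * ((1 + A) * (h \<bullet> g))"
    using inner_ge_of_close[OF crit] norm_sq_le_inner_of_close[OF A crit]
    by (intro mult_mono) auto
  then have "c\<^sup>2 * (((1 - A) * (norm g)\<^sup>2) * (norm h)\<^sup>2) \<le> c\<^sup>2 * ((h \<bullet> g) * ((1 + A) * (h \<bullet> g)))"
    by (intro mult_left_mono) auto
  also have "\<dots> = (1 + A) * (c * (h \<bullet> g))\<^sup>2"
    by (simp add: power2_eq_square algebra_simps)
  also have "c * (h \<bullet> g) = a * (norm h)\<^sup>2"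
    using a \<open>h \<noteq> 0\<close> by simp
  finally have "((1 - A) * (c\<^sup>2 * (norm g)\<^sup>2)) * (norm h)\<^sup>2
      \<le> ((1 + A) * (a\<^sup>2 * (norm h)\<^sup>2)) * (norm h)\<^sup>2"
    by (simp add: power2_eq_square algebra_simps)
  then show ?thesis
    using \<open>h \<noteq> 0\<close> by (simp add: mult_le_cancel_right)
qed

section \<open>From per-step decrease to rates\<close>

text \<open>The decreases telescope, and \<open>K + 1\<close> times the minimum is at most the sum.\<close>
lemma Min_le_of_telescoping_decrease:
  fixes w E :: "nat \<Rightarrow> real"
  assumes step: "\<And>k. k \<le> K \<Longrightarrow> w k \<le> C * (E k - E (Suc k))"
    and "0 \<le> C" "0 \<le> E (Suc K)"
  shows "(MIN k\<in>{0..K}. w k) \<le> C * E 0 / (real K + 1)"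
proof -
  have "real (card {0..K}) * (MIN k\<in>{0..K}. w k) \<le> (\<Sum>k\<in>{0..K}. w k)"
    by (rule sum_bounded_below) simp
  also have "\<dots> \<le> (\<Sum>k\<in>{0..K}. C * (E k - E (Suc k)))"
    by (intro sum_mono step) simp
  also have "\<dots> = C * (E 0 - E (Suc K))"
    using sum_telescope[of E K] by (simp add: atLeast0AtMost flip: sum_distrib_left)
  also have "\<dots> \<le> C * E 0"
    using assms by (intro mult_left_mono) auto
  finally show ?thesis
    by (simp add: field_simps)
qed

text \<open>
  Young's inequality \<open>(p + q)\<^sup>2 \<le> (1 + 1/t) p\<^sup>2 + (1 + t) q\<^sup>2\<close> with \<open>t = 2 A / (1 - A)\<close>, so that
  \<open>1 + t = (1 + A) / (1 - A)\<close>. With this weight the coefficient of \<open>q\<^sup>2\<close> matches exactly, and that of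
  \<open>p\<^sup>2\<close> fits because \<open>m \<le> A\<close>.
\<close>
lemma weighted_young_contraction:
  fixes A m p q d :: real
  assumes A: "0 < A" "A < 1" and m: "0 \<le> m" "m \<le> A" and d: "0 \<le> d" "d \<le> p + q"
  shows "2 * (1 - A) * m / (1 + A)\<^sup>2 * d\<^sup>2
    \<le> (1 - A) / (1 + A) * p\<^sup>2 + 2 * m / (1 + A) * q\<^sup>2"
proof -
  have "d\<^sup>2 \<le> (p + q)\<^sup>2"
    using d by (intro power_mono)
  then have "2 * A * (1 - A) * d\<^sup>2 \<le> 2 * A * (1 - A) * (p + q)\<^sup>2"
    using A by (intro mult_left_mono) auto
  also have "\<dots> = (1 + A) * ((1 - A) * p\<^sup>2 + 2 * A * q\<^sup>2) - ((1 - A) * p - 2 * A * q)\<^sup>2"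
    by (simp add: power2_eq_square algebra_simps)
  also have "\<dots> \<le> (1 + A) * ((1 - A) * p\<^sup>2 + 2 * A * q\<^sup>2)"
    by simp
  finally have "m * (2 * A * (1 - A) * d\<^sup>2) \<le> m * ((1 + A) * ((1 - A) * p\<^sup>2 + 2 * A * q\<^sup>2))"
    using m by (intro mult_left_mono)
  also have "\<dots> = (1 + A) * (m * ((1 - A) * p\<^sup>2) + A * (2 * m * q\<^sup>2))"
    by (simp add: algebra_simps)
  also have "\<dots> \<le> (1 + A) * (A * ((1 - A) * p\<^sup>2) + A * (2 * m * q\<^sup>2))"
    using A m by (intro mult_left_mono add_mono mult_right_mono) auto
  finally have "A * (2 * (1 - A) * m * d\<^sup>2) \<le> A * ((1 + A) * ((1 - A) * p\<^sup>2 + 2 * m * q\<^sup>2))"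
    by (simp add: algebra_simps)
  then have "2 * (1 - A) * m * d\<^sup>2 \<le> (1 + A) * ((1 - A) * p\<^sup>2 + 2 * m * q\<^sup>2)"
    using A by (simp add: mult_le_cancel_left_pos)
  then have "2 * (1 - A) * m * d\<^sup>2 / (1 + A)\<^sup>2
      \<le> (1 + A) * ((1 - A) * p\<^sup>2 + 2 * m * q\<^sup>2) / (1 + A)\<^sup>2"
    by (intro divide_right_mono) auto
  also have "\<dots> = (1 - A) / (1 + A) * p\<^sup>2 + 2 * m / (1 + A) * q\<^sup>2"
    using A by (simp add: power2_eq_square[of "1 + A"] add_divide_distrib)
  finally show ?thesis
    by simp
qed

text \<open>
  Over the extrapolation step \<open>x - xh = c F x\<close>, strong monotonicity gives
  \<open>\<parallel>F x - F xh\<parallel> \<ge> \<mu> c \<parallel>F x\<parallel>\<close>, against the upper bound \<open>A \<parallel>F x\<parallel>\<close>.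
\<close>
lemma strongly_monotone_stepsize_le:
  assumes sm: "strongly_monotone_operator \<mu> F" and "0 < c" and "F x \<noteq> 0"
    and crit: "norm (F (x - c *\<^sub>R F x) - F x) \<le> A * norm (F x)"
  shows "c * \<mu> \<le> A"
proof -
  define y where "y = x - c *\<^sub>R F x"
  have xy: "x - y = c *\<^sub>R F x"
    by (simp add: y_def)
  have "\<mu> * (norm (x - y))\<^sup>2 \<le> (F x - F y) \<bullet> (x - y)"
    using sm by (simp add: strongly_monotone_operator_def)
  also have "\<dots> \<le> norm (F x - F y) * norm (x - y)"
    by (rule norm_cauchy_schwarz)
  also have "\<dots> \<le> A * norm (F x) * norm (x - y)"
    using crit by (intro mult_right_mono) (auto simp: y_def norm_minus_commute)
  finally have "(c * \<mu>) * (c * (norm (F x))\<^sup>2) \<le> A * (c * (norm (F x))\<^sup>2)"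
    using \<open>0 < c\<close> by (simp add: xy power2_eq_square algebra_simps)
  then show ?thesis
    using \<open>0 < c\<close> \<open>F x \<noteq> 0\<close> by (simp add: mult_le_cancel_right_pos)
qed

section \<open>Convergence of PolyakEG\<close>

theorem theorem3p4:
  fixes F :: "real ^ 'd \<Rightarrow> real ^ 'd"
    and \<gamma> \<alpha> :: "nat \<Rightarrow> real"
    and x0 xs :: "real ^ 'd"
    and x xh :: "nat \<Rightarrow> real ^ 'd"
    and N :: enat
    and A :: real
  assumes "monotone_operator F"
    and "solution_set F \<noteq> {}"
    and "xs \<in> solution_set F"
    and "polyakEG F \<gamma> x0 N x xh \<alpha>"
    and "\<forall>k. enat k < N \<longrightarrow> norm (F (xh k) - F (x k)) \<le> A * norm (F (x k))"
  shows "(A \<in> {0<..1} \<longrightarrow>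
           (\<forall>K. enat K < N \<longrightarrow>
             (MIN k\<in>{0..K}. (\<gamma> k)\<^sup>2 * (norm (F (xh k)))\<^sup>2)
               \<le> (1 + A)\<^sup>2 * (norm (x0 - xs))\<^sup>2 / (real K + 1)))
       \<and> (A \<in> {0<..<1} \<longrightarrow>
           (\<forall>K. enat K < N \<longrightarrow>
             (MIN k\<in>{0..K}. (\<gamma> k)\<^sup>2 * (norm (F (x k)))\<^sup>2)
               \<le> (1 + A) * (norm (x0 - xs))\<^sup>2 / ((1 - A) * (real K + 1))))
       \<and> (\<forall>\<mu>>0. strongly_monotone_operator \<mu> F \<and> A \<in> {0<..<1} \<longrightarrow>
           (\<forall>k. enat k < N \<longrightarrow>
             (norm (x (Suc k) - xs))\<^sup>2
               \<le> (\<Prod>j=0..k. 1 - 2 * (1 - A) * \<gamma> j * \<mu> / (1 + A)\<^sup>2) * (norm (x0 - xs))\<^sup>2))"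
proof -
  have Fxs: "F xs = 0"
    using assms(3) by (simp add: solution_set_def)
  define E where "E k = (norm (x k - xs))\<^sup>2" for k
  have E0: "E 0 = (norm (x0 - xs))\<^sup>2"
    using assms(4) by (simp add: E_def polyakEG_def)
  have E_nonneg: "0 \<le> E k" for k
    by (simp add: E_def)
  have below: "enat j < N" if "j \<le> k" "enat k < N" for j k
    using that by (meson enat_ord_simps(1) le_less_trans)
  have pos: "0 < \<gamma> k" and nz: "F (xh k) \<noteq> 0"
    and crit: "norm (F (xh k) - F (x k)) \<le> A * norm (F (x k))"
    and xh: "xh k = x k - \<gamma> k *\<^sub>R F (x k)"
    and \<alpha>: "\<alpha> k = (F (xh k) \<bullet> (\<gamma> k *\<^sub>R F (x k))) / (norm (F (xh k)))\<^sup>2"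
    and next_x: "x (Suc k) = x k - \<alpha> k *\<^sub>R F (xh k)" if "enat k < N" for k
    using assms(4,5) that by (auto simp: polyakEG_def)
  have E_Suc: "E (Suc k) = E k - (\<alpha> k)\<^sup>2 * (norm (F (xh k)))\<^sup>2
      - 2 * \<alpha> k * (F (xh k) \<bullet> (xh k - xs))" if k: "enat k < N" for k
    using polyak_step_distance[OF nz[OF k] \<alpha>[OF k], of "x k - xs"]
    by (simp add: E_def next_x[OF k] xh[OF k] algebra_simps)
  have \<alpha>_ge: "\<gamma> k / (1 + A) \<le> \<alpha> k" and \<alpha>_pos: "0 < \<alpha> k"
    if "0 < A" "A \<le> 1" and k: "enat k < N" for k
  proof -
    show "\<gamma> k / (1 + A) \<le> \<alpha> k"
      using that by (intro polyak_stepsize_ge[OF _ _ crit[OF k] nz[OF k] pos[OF k] \<alpha>[OF k]]) auto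
    then show "0 < \<alpha> k"
      using pos[OF k] \<open>0 < A\<close> by (smt (verit) divide_pos_pos)
  qed
  have decrease: "(\<alpha> k)\<^sup>2 * (norm (F (xh k)))\<^sup>2 \<le> E k - E (Suc k)"
    if "0 < A" "A \<le> 1" and k: "enat k < N" for k
  proof -
    have "0 \<le> F (xh k) \<bullet> (xh k - xs)"
      using assms(1) Fxs unfolding monotone_operator_def by (metis diff_zero)
    then have "0 \<le> \<alpha> k * (F (xh k) \<bullet> (xh k - xs))"
      using \<alpha>_pos[OF that] by simp
    then show ?thesis
      using E_Suc[OF k] by linarith
  qed
  have bound_extrapolated: "(\<gamma> k)\<^sup>2 * (norm (F (xh k)))\<^sup>2 \<le> (1 + A)\<^sup>2 * (E k - E (Suc k))"
    if "0 < A" "A \<le> 1" and k: "enat k < N" for k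
  proof -
    have "\<gamma> k \<le> (1 + A) * \<alpha> k"
      using \<alpha>_ge[OF that] \<open>0 < A\<close> by (simp add: field_simps)
    then have "(\<gamma> k)\<^sup>2 * (norm (F (xh k)))\<^sup>2 \<le> ((1 + A) * \<alpha> k)\<^sup>2 * (norm (F (xh k)))\<^sup>2"
      using pos[OF k] by (intro mult_right_mono power_mono) auto
    also have "\<dots> = (1 + A)\<^sup>2 * ((\<alpha> k)\<^sup>2 * (norm (F (xh k)))\<^sup>2)"
      by (simp add: power_mult_distrib)
    also have "\<dots> \<le> (1 + A)\<^sup>2 * (E k - E (Suc k))"
      using decrease[OF that] by (intro mult_left_mono) auto
    finally show ?thesis .
  qed
  have length_ge: "(1 - A) * ((\<gamma> k)\<^sup>2 * (norm (F (x k)))\<^sup>2)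
      \<le> (1 + A) * ((\<alpha> k)\<^sup>2 * (norm (F (xh k)))\<^sup>2)"
    if "0 < A" "A < 1" and k: "enat k < N" for k
    using that by (intro polyak_step_length_ge[OF _ _ crit[OF k] nz[OF k] \<alpha>[OF k]]) auto
  have bound_current: "(\<gamma> k)\<^sup>2 * (norm (F (x k)))\<^sup>2 \<le> (1 + A) / (1 - A) * (E k - E (Suc k))"
    if "0 < A" "A < 1" and k: "enat k < N" for k
  proof -
    have "(1 + A) * ((\<alpha> k)\<^sup>2 * (norm (F (xh k)))\<^sup>2) \<le> (1 + A) * (E k - E (Suc k))"
      using decrease[of k] that by (intro mult_left_mono) auto
    with length_ge[OF that]
    have "(1 - A) * ((\<gamma> k)\<^sup>2 * (norm (F (x k)))\<^sup>2) \<le> (1 + A) * (E k - E (Suc k))"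
      by linarith
    then show ?thesis
      using \<open>A < 1\<close> by (simp add: pos_le_divide_eq mult.commute)
  qed

  have rate_extrapolated: "(MIN k\<in>{0..K}. (\<gamma> k)\<^sup>2 * (norm (F (xh k)))\<^sup>2)
      \<le> (1 + A)\<^sup>2 * (norm (x0 - xs))\<^sup>2 / (real K + 1)"
    if "A \<in> {0<..1}" "enat K < N" for K
    using that below bound_extrapolated E_nonneg unfolding E0[symmetric]
    by (intro Min_le_of_telescoping_decrease) auto

  have rate_current: "(MIN k\<in>{0..K}. (\<gamma> k)\<^sup>2 * (norm (F (x k)))\<^sup>2)
      \<le> (1 + A) * (norm (x0 - xs))\<^sup>2 / ((1 - A) * (real K + 1))"
    if "A \<in> {0<..<1}" "enat K < N" for K
  proof -
    have "(MIN k\<in>{0..K}. (\<gamma> k)\<^sup>2 * (norm (F (x k)))\<^sup>2) \<le> (1 + A) / (1 - A) * E 0 / (real K + 1)"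
      using that below bound_current E_nonneg
      by (intro Min_le_of_telescoping_decrease) auto
    then show ?thesis
      by (simp add: E0)
  qed

  have linear_rate: "(norm (x (Suc k) - xs))\<^sup>2
      \<le> (\<Prod>j=0..k. 1 - 2 * (1 - A) * \<gamma> j * \<mu> / (1 + A)\<^sup>2) * (norm (x0 - xs))\<^sup>2"
    if \<mu>: "0 < \<mu>" and sm: "strongly_monotone_operator \<mu> F" and "A \<in> {0<..<1}" and "enat k < N"
    for \<mu> k
  proof -
    have A: "0 < A" "A < 1"
      using that by auto
    define \<rho> where "\<rho> j = 1 - 2 * (1 - A) * \<gamma> j * \<mu> / (1 + A)\<^sup>2" for j
    have m_le: "\<gamma> j * \<mu> \<le> A" if j: "enat j < N" for j
    proof (rule strongly_monotone_stepsize_le[OF sm pos[OF j]])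
      show "norm (F (x j - \<gamma> j *\<^sub>R F (x j)) - F (x j)) \<le> A * norm (F (x j))"
        using crit[OF j] xh[OF j] by simp
      show "F (x j) \<noteq> 0"
        using nz[OF j] xh[OF j] by auto
    qed
    have \<rho>_nonneg: "0 \<le> \<rho> j" if j: "enat j < N" for j
    proof -
      have "2 * (1 - A) * (\<gamma> j * \<mu>) \<le> 2 * (1 - A) * A"
        using A m_le[OF j] by (intro mult_left_mono) auto
      also have "\<dots> \<le> (1 + A)\<^sup>2"
        by (simp add: power2_eq_square algebra_simps)
      finally show ?thesis
        using A by (simp add: \<rho>_def field_simps)
    qed
    have contraction: "E (Suc j) \<le> \<rho> j * E j" if j: "enat j < N" for j
    proof -
      define p where "p = norm (\<gamma> j *\<^sub>R F (x j))"
      define q where "q = norm (xh j - xs)"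
      have "norm (x j - xs) \<le> p + q"
        using norm_triangle_ineq[of "\<gamma> j *\<^sub>R F (x j)" "xh j - xs"] by (simp add: p_def q_def xh[OF j])
      then have "2 * (1 - A) * (\<gamma> j * \<mu>) / (1 + A)\<^sup>2 * E j
          \<le> (1 - A) / (1 + A) * p\<^sup>2 + 2 * (\<gamma> j * \<mu>) / (1 + A) * q\<^sup>2"
        unfolding E_def using A m_le[OF j] pos[OF j] \<mu>
        by (intro weighted_young_contraction) auto
      moreover have "(1 - A) / (1 + A) * p\<^sup>2 \<le> (\<alpha> j)\<^sup>2 * (norm (F (xh j)))\<^sup>2"
        using length_ge[OF A j] A by (simp add: p_def power_mult_distrib field_simps)
      moreover have "2 * (\<gamma> j * \<mu>) / (1 + A) * q\<^sup>2 \<le> 2 * \<alpha> j * (F (xh j) \<bullet> (xh j - xs))"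
      proof -
        have "(\<gamma> j / (1 + A)) * (\<mu> * q\<^sup>2) \<le> \<alpha> j * (F (xh j) \<bullet> (xh j - xs))"
        proof (intro mult_mono)
          show "\<mu> * q\<^sup>2 \<le> F (xh j) \<bullet> (xh j - xs)"
            using sm Fxs unfolding strongly_monotone_operator_def q_def by (metis diff_zero)
        qed (use \<alpha>_ge[of j] \<alpha>_pos[of j] A j \<mu> in auto)
        then show ?thesis
          by (simp add: mult.assoc)
      qed
      ultimately show ?thesis
        using E_Suc[OF j] by (simp add: \<rho>_def algebra_simps)
    qed
    have "E (Suc k) \<le> (\<Prod>j=0..k. \<rho> j) * E 0"
      using \<open>enat k < N\<close>
    proof (induction k)
      case 0
      then show ?case
        using contraction[of 0] by simp
    next
      case (Suc k)
      have "E (Suc (Suc k)) \<le> \<rho> (Suc k) * E (Suc k)"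
        by (rule contraction[OF Suc.prems])
      also have "\<dots> \<le> \<rho> (Suc k) * ((\<Prod>j=0..k. \<rho> j) * E 0)"
        using Suc.IH below[OF _ Suc.prems, of k] \<rho>_nonneg[OF Suc.prems]
        by (intro mult_left_mono) auto
      finally show ?case
        by (simp add: mult_ac)
    qed
    then show ?thesis
      unfolding E0 by (simp add: E_def \<rho>_def)
  qed

  show ?thesis
    using rate_extrapolated rate_current linear_rate by blast
qed

end
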